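(* Let $G$ be the graph with vertex set $\{1,2,\ldots,8\}$ and edge set $\{12, 13, 14, 25, 26, 34, 37, 48, 56, 58, 67, 78\}$. Consider the three graphs (up to isomorphism) $G$, $G+38$ (which is isomorphic to $G+47$), and $G+38+47$, each of order $n=8$. Each of these graphs has property $\mathfrak{P}_{n}$ but does not have property $\mathfrak{P}_{n/2+1}$ (that is, each has $\mathfrak{P}_8$ but not $\mathfrak{P}_5$). Moreover, these are the smallest counterexamples to the Faudree-Schelp Conjecture: no graph on fewer than $8$ vertices is a counterexample, and every counterexample on exactly $8$ vertices is isomorphic to one of these three graphs.
   Context: All graphs are finite and simple; $uv$ denotes the edge between $u$ and $v$, and $G+uv$ denotes $G$ with the edge $uv$ added. The length of a path is its number of edges. A graph has property $\mathfrak{P}_k$ if for any two distinct vertices $u$ and $v$ there is a path between $u$ and $v$ with exactly $k$ vertices (i.e. of length $k-1$). A graph on $n$ vertices is hamiltonian-connected if between every two distinct vertices there is a hamiltonian path, i.e. if it has $\mathfrak{P}_n$. The Faudree-Schelp Conjecture asserts that for every hamiltonian-connected graph on $n$ vertices and every two distinct vertices $u,v$ there is a path between $u$ and $v$ of length $k$ for every integer $k$ with $\frac{n}{2}\le k\le n-1$. A counterexample is a hamiltonian-connected graph on $n$ vertices having two distinct vertices $u,v$ and an integer $k$ with $\frac n2\le k\le n-1$ such that there is no path of length $k$ between $u$ and $v$. *)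

theory Defs
  imports Complex_Main
begin

text \<open>A graph is a pair of a vertex set and an edge set, an edge being the set of its two ends.\<close>

type_synonym 'a graph = "'a set \<times> 'a set set"

definition verts :: "'a graph \<Rightarrow> 'a set" where
  "verts G = fst G"

definition edges :: "'a graph \<Rightarrow> 'a set set" where
  "edges G = snd G"

definition order_of :: "'a graph \<Rightarrow> nat" where
  "order_of G = card (verts G)"

definition simple_graph :: "'a graph \<Rightarrow> bool" where
  "simple_graph G \<longleftrightarrow>
     finite (verts G) \<and> (\<forall>e \<in> edges G. \<exists>u \<in> verts G. \<exists>v \<in> verts G. u \<noteq> v \<and> e = {u, v})"

definition add_edge :: "'a graph \<Rightarrow> 'a \<Rightarrow> 'a \<Rightarrow> 'a graph" where
  "add_edge G u v = (verts G, insert {u, v} (edges G))"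

definition isomorphic :: "'a graph \<Rightarrow> 'b graph \<Rightarrow> bool" where
  "isomorphic G H \<longleftrightarrow>
     (\<exists>f. bij_betw f (verts G) (verts H) \<and>
          (\<forall>u \<in> verts G. \<forall>v \<in> verts G. {u, v} \<in> edges G \<longleftrightarrow> {f u, f v} \<in> edges H))"

text \<open>A path is given by the list of its vertices.\<close>

definition path_between :: "'a graph \<Rightarrow> 'a \<Rightarrow> 'a \<Rightarrow> 'a list \<Rightarrow> bool" where
  "path_between G u v p \<longleftrightarrow>
     p \<noteq> [] \<and> hd p = u \<and> last p = v \<and> distinct p \<and> set p \<subseteq> verts G \<and>
     (\<forall>i. Suc i < length p \<longrightarrow> {p ! i, p ! Suc i} \<in> edges G)"

definition path_length :: "'a list \<Rightarrow> nat" where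
  "path_length p = length p - 1"

definition has_prop_P :: "nat \<Rightarrow> 'a graph \<Rightarrow> bool" where
  "has_prop_P k G \<longleftrightarrow>
     (\<forall>u \<in> verts G. \<forall>v \<in> verts G. u \<noteq> v \<longrightarrow> (\<exists>p. path_between G u v p \<and> length p = k))"

definition hamiltonian_connected :: "'a graph \<Rightarrow> bool" where
  "hamiltonian_connected G \<longleftrightarrow>
     (\<forall>u \<in> verts G. \<forall>v \<in> verts G. u \<noteq> v \<longrightarrow> (\<exists>p. path_between G u v p \<and> set p = verts G))"

lemma hamiltonian_connected_iff_has_prop_P:
  assumes "simple_graph G"
  shows "hamiltonian_connected G \<longleftrightarrow> has_prop_P (order_of G) G"
proof -
  have "set p = verts G \<longleftrightarrow> length p = order_of G" if "path_between G u v p" for u v p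
    using that assms
    unfolding path_between_def simple_graph_def order_of_def
    by (metis card_subset_eq distinct_card)
  then show ?thesis
    unfolding hamiltonian_connected_def has_prop_P_def by blast
qed

definition faudree_schelp_counterexample :: "'a graph \<Rightarrow> bool" where
  "faudree_schelp_counterexample G \<longleftrightarrow>
     simple_graph G \<and> hamiltonian_connected G \<and>
     (\<exists>u \<in> verts G. \<exists>v \<in> verts G. \<exists>k::nat. u \<noteq> v \<and>
        real (order_of G) / 2 \<le> real k \<and> k \<le> order_of G - 1 \<and>
        \<not> (\<exists>p. path_between G u v p \<and> path_length p = k))"

definition graph_G :: "nat graph" where
  "graph_G = ({1..8},
     {{1,2}, {1,3}, {1,4}, {2,5}, {2,6}, {3,4}, {3,7}, {4,8}, {5,6}, {5,8}, {6,7}, {7,8}})"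

end

theory Submission
  imports Defs
begin

text \<open>Suppose that \<open>H\<close> is hamiltonian-connected on \<open>n\<close> vertices and has no path of length \<open>k\<close> between two
  of its vertices. Number the vertices \<open>0, \<dots>, n - 1\<close> along a hamiltonian path joining these two. A
  short case distinction on the presence of the remaining edges then leads, in each case, to a path
  of length \<open>k\<close> from \<open>0\<close> to \<open>n - 1\<close>, or to a set of \<open>s \<ge> 2\<close> vertices whose removal leaves at least
  \<open>s\<close> components (which prevents a hamiltonian path between two of the removed vertices), or to a copy
  of \<open>G\<close> in \<open>H\<close> that shows \<open>H\<close> to lie between \<open>G\<close> and \<open>G + 38 + 47\<close>. The case distinctions are given
  by certificates, which a verified checker evaluates.\<close>

section \<open>Hamiltonian-connected graphs and separators\<close>

lemma path_between_iff_successively: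
  "path_between G u v p \<longleftrightarrow> p \<noteq> [] \<and> hd p = u \<and> last p = v \<and> distinct p \<and> set p \<subseteq> verts G \<and>
     successively (\<lambda>x y. {x, y} \<in> edges G) p"
  by (simp add: path_between_def successively_conv_nth)

lemma path_between_rev:
  assumes "path_between G u v p"
  shows "path_between G v u (rev p)"
  using assms
  by (auto simp: path_between_iff_successively hd_rev last_rev insert_commute)

lemma path_between_mono:
  assumes "path_between G u v p" "verts G = verts H" "edges G \<subseteq> edges H"
  shows "path_between H u v p"
  using assms by (auto simp: path_between_def)

lemma has_prop_P_mono:
  assumes "has_prop_P k G" "verts G = verts H" "edges G \<subseteq> edges H"
  shows "has_prop_P k H"
  using assms unfolding has_prop_P_def by (metis path_between_mono)

text \<open>Consecutive vertices of positive colour share that colour, and each such stretch is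
  followed by a zero of its own, as the list ends with colour 0. A zero at the start follows no
  stretch and is left over; the conditional term records it and carries the induction.\<close>

lemma card_colours_le:
  fixes col :: "'a \<Rightarrow> nat"
  assumes "p \<noteq> []" "col (last p) = 0"
    and "successively (\<lambda>x y. col x = 0 \<or> col y = 0 \<or> col x = col y) p"
  shows "card (col ` set p - {0}) + (if col (hd p) = 0 then 1 else 0)
    \<le> length (filter (\<lambda>v. col v = 0) p)"
  using assms
proof (induction p)
  case (Cons x q)
  show ?case
  proof (cases "q = []")
    case False
    with Cons.prems have q: "col (last q) = 0"
      "successively (\<lambda>x y. col x = 0 \<or> col y = 0 \<or> col x = col y) q"
      and hd: "col x = 0 \<or> col (hd q) = 0 \<or> col x = col (hd q)"
      by (auto simp: successively_Cons)
    note IH = Cons.IH[OF False q]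
    show ?thesis
    proof (cases "col x = 0")
      case True
      with IH show ?thesis by simp
    next
      case nz: False
      then have *: "col ` set (x # q) - {0} = insert (col x) (col ` set q - {0})" by auto
      show ?thesis
      \<comment> \<open>A new colour can enter only directly before a vertex of colour 0; the extra
        1 in the induction hypothesis then pays for it.\<close>
      proof (cases "col (hd q) = 0")
        case True
        with IH nz * card_insert_le_m1 show ?thesis
          by (simp add: card_insert_if)
      next
        case False
        with hd nz have "col x = col (hd q)" by simp
        with False \<open>q \<noteq> []\<close> have "col x \<in> col ` set q - {0}" by auto
        with * have "col ` set (x # q) - {0} = col ` set q - {0}" by (simp add: insert_absorb)
        with IH False nz show ?thesis by simp
      qed
    qed
  qed (use Cons.prems in auto)
qed simp

text \<open>A hamiltonian path between two removed vertices starts and ends in the removed set, so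
  \<open>s\<close> removed vertices leave at most \<open>s - 1\<close> gaps, while each positive
  colour needs a gap of its own.\<close>

lemma hamiltonian_connected_separator:
  fixes col :: "'a \<Rightarrow> nat"
  assumes "hamiltonian_connected G"
    and "x \<in> verts G" "y \<in> verts G" "x \<noteq> y" "col x = 0" "col y = 0"
    and sep: "\<And>u v. \<lbrakk>u \<in> verts G; v \<in> verts G; {u, v} \<in> edges G\<rbrakk>
      \<Longrightarrow> col u = 0 \<or> col v = 0 \<or> col u = col v"
  shows "card (col ` verts G - {0}) < card {v \<in> verts G. col v = 0}"
proof -
  obtain p where p: "path_between G x y p" "set p = verts G"
    using assms unfolding hamiltonian_connected_def by blast
  then have "successively (\<lambda>x y. col x = 0 \<or> col y = 0 \<or> col x = col y) p"
    unfolding path_between_iff_successively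
    by (elim conjE successively_mono) (auto simp: sep)
  moreover have "length (filter (\<lambda>v. col v = 0) p) = card {v \<in> verts G. col v = 0}"
    using p distinct_card[of "filter (\<lambda>v. col v = 0) p"]
    by (simp add: path_between_def)
  ultimately show ?thesis
    using card_colours_le[of p col] p assms(5,6) by (simp add: path_between_def)
qed

section \<open>Isomorphisms\<close>

lemma isomorphic_sym:
  assumes "isomorphic G H"
  shows "isomorphic H G"
proof -
  obtain f where f: "bij_betw f (verts G) (verts H)"
    "\<And>u v. \<lbrakk>u \<in> verts G; v \<in> verts G\<rbrakk> \<Longrightarrow> {u, v} \<in> edges G \<longleftrightarrow> {f u, f v} \<in> edges H"
    using assms unfolding isomorphic_def by auto
  let ?g = "the_inv_into (verts G) f"
  have "?g u \<in> verts G" "f (?g u) = u" if "u \<in> verts H" for u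
    using f(1) that by (auto simp: bij_betw_def intro: the_inv_into_into f_the_inv_into_f)
  then have "{u, v} \<in> edges H \<longleftrightarrow> {?g u, ?g v} \<in> edges G" if "u \<in> verts H" "v \<in> verts H" for u v
    using f(2) that by simp
  then show ?thesis
    unfolding isomorphic_def using bij_betw_the_inv_into[OF f(1)] by blast
qed

lemma isomorphic_trans:
  assumes "isomorphic F G" "isomorphic G H"
  shows "isomorphic F H"
proof -
  obtain f g where f: "bij_betw f (verts F) (verts G)"
    "\<forall>u \<in> verts F. \<forall>v \<in> verts F. {u, v} \<in> edges F \<longleftrightarrow> {f u, f v} \<in> edges G"
    and g: "bij_betw g (verts G) (verts H)"
    "\<forall>u \<in> verts G. \<forall>v \<in> verts G. {u, v} \<in> edges G \<longleftrightarrow> {g u, g v} \<in> edges H"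
    using assms unfolding isomorphic_def by auto
  have "f u \<in> verts G" if "u \<in> verts F" for u
    using f(1) that by (rule bij_betwE[THEN bspec])
  then show ?thesis
    unfolding isomorphic_def using f g bij_betw_trans[OF f(1) g(1)]
    by (intro exI[of _ "g \<circ> f"]) simp
qed

text \<open>Serves to tell the three graphs apart. A bijection of the vertices acts injectively on
  sets of vertices, and this action takes the edge set onto the edge set.\<close>

lemma isomorphic_card_edges:
  assumes "simple_graph G" "simple_graph H" "isomorphic G H"
  shows "card (edges G) = card (edges H)"
proof -
  obtain f where f: "bij_betw f (verts G) (verts H)"
    "\<And>u v. \<lbrakk>u \<in> verts G; v \<in> verts G\<rbrakk> \<Longrightarrow> {u, v} \<in> edges G \<longleftrightarrow> {f u, f v} \<in> edges H"
    using assms(3) unfolding isomorphic_def by auto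
  have "edges G \<subseteq> Pow (verts G)"
    using assms(1) by (auto simp: simple_graph_def)
  with f(1) have "inj_on ((`) f) (edges G)"
    by (auto simp: bij_betw_def intro: inj_on_subset[OF inj_on_image_Pow])
  moreover have "(`) f ` edges G = edges H"
  proof (intro equalityI subsetI)
    fix e assume "e \<in> (`) f ` edges G"
    then obtain d where "d \<in> edges G" "e = f ` d" by blast
    moreover from this obtain u v where "u \<in> verts G" "v \<in> verts G" "d = {u, v}"
      using assms(1) unfolding simple_graph_def by blast
    ultimately show "e \<in> edges H" using f(2) by simp
  next
    fix e assume e: "e \<in> edges H"
    then obtain x y where "x \<in> verts H" "y \<in> verts H" "e = {x, y}"
      using assms(2) unfolding simple_graph_def by blast
    moreover from this obtain u v where "u \<in> verts G" "v \<in> verts G" "f u = x" "f v = y"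
      using f(1) by (metis bij_betw_imp_surj_on imageE)
    ultimately have "{u, v} \<in> edges G" "e = f ` {u, v}" using f(2) e by simp_all
    then show "e \<in> (`) f ` edges G" by blast
  qed
  ultimately show ?thesis by (metis card_image)
qed

section \<open>The three graphs\<close>

definition G_edges :: "(nat \<times> nat) list" where
  "G_edges = [(1,2), (1,3), (1,4), (2,5), (2,6), (3,4), (3,7), (4,8), (5,6), (5,8), (6,7), (7,8)]"

definition graph_of :: "(nat \<times> nat) list \<Rightarrow> nat graph" where
  "graph_of es = ({1..8}, (\<lambda>(i, j). {i, j}) ` set es)"

text \<open>An edge may be listed in one orientation only, hence the disjunction. Being executable,
  the predicate lets \<open>code_simp\<close> decide adjacency in concrete graphs.\<close>

definition joined :: "(nat \<times> nat) list \<Rightarrow> nat \<Rightarrow> nat \<Rightarrow> bool" where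
  "joined es i j \<longleftrightarrow> (i, j) \<in> set es \<or> (j, i) \<in> set es"

lemma verts_graph_of [simp]: "verts (graph_of es) = {1..8}"
  by (simp add: verts_def graph_of_def)

lemma edges_graph_of: "{i, j} \<in> edges (graph_of es) \<longleftrightarrow> joined es i j"
proof -
  have "{i, j} \<in> edges (graph_of es) \<longleftrightarrow> (\<exists>a b. (a, b) \<in> set es \<and> {i, j} = {a, b})"
    by (auto simp: edges_def graph_of_def image_iff Bex_def)
  then show ?thesis
    unfolding joined_def doubleton_eq_iff by blast
qed

lemma edges_graph_of_mono: "set es \<subseteq> set es' \<Longrightarrow> edges (graph_of es) \<subseteq> edges (graph_of es')"
  by (auto simp: edges_def graph_of_def)

lemma simple_graph_of:
  assumes "\<forall>(i, j) \<in> set es. i \<in> {1..8} \<and> j \<in> {1..8} \<and> i \<noteq> j"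
  shows "simple_graph (graph_of es)"
  unfolding simple_graph_def
proof (intro conjI ballI)
  fix e assume "e \<in> edges (graph_of es)"
  then obtain i j where "(i, j) \<in> set es" "e = {i, j}"
    by (auto simp: edges_def graph_of_def)
  with assms show "\<exists>u \<in> verts (graph_of es). \<exists>v \<in> verts (graph_of es). u \<noteq> v \<and> e = {u, v}"
    unfolding verts_graph_of by blast
qed simp

lemma set_upt_1_9: "set [1..<9] = {1..8::nat}"
  by auto

lemma graph_G_eq: "graph_G = graph_of G_edges"
  by (simp add: graph_G_def graph_of_def G_edges_def)

lemma add_edge_graph_of: "add_edge (graph_of es) u v = graph_of ((u, v) # es)"
  by (simp add: add_edge_def graph_of_def verts_def edges_def)

text \<open>The map runs from the labels to \<open>H\<close>, opposite to the isomorphism obtained,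
  because labellings of \<open>H\<close> are what the certificates produce.\<close>

lemma isomorphic_graph_ofI:
  assumes "bij_betw g {1..8} (verts H)"
    and "\<And>i j. \<lbrakk>i \<in> {1..8}; j \<in> {1..8}\<rbrakk> \<Longrightarrow> {g i, g j} \<in> edges H \<longleftrightarrow> joined es i j"
  shows "isomorphic H (graph_of es)"
  by (rule isomorphic_sym)
    (use assms in \<open>auto simp: isomorphic_def edges_graph_of\<close>)

text \<open>Exchanging 3 with 4, 5 with 6 and 7 with 8 is an automorphism of \<open>G\<close>.\<close>

lemma isomorphic_G_38_G_47:
  "isomorphic (graph_of ((3, 8) # G_edges)) (graph_of ((4, 7) # G_edges))"
proof -
  \<comment> \<open>The leading 0 is a dummy entry: vertices count from 1, list positions from
    0.\<close>
  let ?g = "\<lambda>i. [0, 1, 2, 4, 3, 6, 5, 8, 7] ! i :: nat"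
  have "?g ` set [1..<9] = set [1..<9]"
    by code_simp
  then have "?g ` {1..8} = {1..8}"
    by (simp only: set_upt_1_9)
  then have "bij_betw ?g {1..8} (verts (graph_of ((3, 8) # G_edges)))"
    by (simp add: bij_betw_def eq_card_imp_inj_on)
  moreover have "\<forall>i \<in> set [1..<9]. \<forall>j \<in> set [1..<9].
      joined ((3, 8) # G_edges) (?g i) (?g j) \<longleftrightarrow> joined ((4, 7) # G_edges) i j"
    unfolding joined_def G_edges_def by code_simp
  ultimately show ?thesis
    by (intro isomorphic_graph_ofI) (auto simp: edges_graph_of)
qed

section \<open>Hamiltonian paths in \<open>G\<close> and the missing path between 3 and 4\<close>

text \<open>The list holds one hamiltonian path for each of the 28 pairs of vertices; reversal
  supplies the other direction. Adding edges preserves the property, so treating \<open>G\<close>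
  suffices for all three graphs.\<close>

lemma has_prop_P_8_graph_G: "has_prop_P 8 graph_G"
proof -
  define ps :: "nat list list" where "ps = [
    [1,3,4,8,7,6,5,2], [1,2,5,6,7,8,4,3], [1,2,6,5,8,7,3,4], [1,2,6,7,3,4,8,5],
    [1,2,5,8,4,3,7,6], [1,2,6,5,8,4,3,7], [1,2,5,6,7,3,4,8], [2,1,4,8,5,6,7,3],
    [2,1,3,7,6,5,8,4], [2,1,3,4,8,7,6,5], [2,1,4,3,7,8,5,6], [2,1,3,4,8,5,6,7],
    [2,1,4,3,7,6,5,8], [3,1,2,5,6,7,8,4], [3,1,4,8,7,6,2,5], [3,4,1,2,5,8,7,6],
    [3,1,4,8,5,2,6,7], [3,4,1,2,5,6,7,8], [4,3,1,2,6,7,8,5], [4,1,3,7,8,5,2,6],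
    [4,3,1,2,6,5,8,7], [4,1,3,7,6,2,5,8], [5,2,1,3,4,8,7,6], [5,6,2,1,3,4,8,7],
    [5,2,6,7,3,1,4,8], [6,2,5,8,4,1,3,7], [6,5,2,1,4,3,7,8], [7,3,4,1,2,6,5,8]]"
  have paths: "path_between graph_G (hd p) (last p) p \<and> length p = 8" if "p \<in> set ps" for p
  proof -
    have "\<forall>p \<in> set ps. length p = 8 \<and> distinct p \<and> list_all (\<lambda>i. 1 \<le> i \<and> i \<le> 8) p \<and>
        successively (joined G_edges) p"
      unfolding ps_def joined_def[abs_def] G_edges_def by code_simp
    with that have p: "length p = 8" "distinct p" "list_all (\<lambda>i. 1 \<le> i \<and> i \<le> 8) p"
        "successively (joined G_edges) p"
      by blast+
    then have "p \<noteq> []" by auto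
    with p show ?thesis
      by (auto simp: path_between_iff_successively graph_G_eq edges_graph_of list_all_iff)
  qed
  have "\<forall>u \<in> set [1..<9]. \<forall>v \<in> set [1..<9]. u = v \<or>
      (\<exists>p \<in> set ps. hd p = u \<and> last p = v \<or> hd p = v \<and> last p = u)"
    unfolding ps_def by code_simp
  then have ends: "\<exists>p \<in> set ps. hd p = u \<and> last p = v \<or> hd p = v \<and> last p = u"
    if "u \<in> {1..8}" "v \<in> {1..8}" "u \<noteq> v" for u v
    using that unfolding set_upt_1_9 by blast
  show ?thesis
    unfolding has_prop_P_def
  proof (intro ballI impI)
    fix u v assume "u \<in> verts graph_G" "v \<in> verts graph_G" "u \<noteq> v"
    then obtain p where "p \<in> set ps" "hd p = u \<and> last p = v \<or> hd p = v \<and> last p = u"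
      using ends unfolding graph_G_eq verts_graph_of by blast
    with paths[OF this(1)] show "\<exists>p. path_between graph_G u v p \<and> length p = 8"
      by (metis path_between_rev length_rev)
  qed
qed

text \<open>Five vertices mean length 4, half the order. The largest of the three graphs is taken,
  since deleting edges creates no path; all triples of inner vertices are tried.\<close>

lemma no_path_3_4:
  assumes "path_between (graph_of ((4, 7) # (3, 8) # G_edges)) 3 4 p"
  shows "length p \<noteq> 5"
proof
  assume "length p = 5"
  then obtain a b c d e where p: "p = [a, b, c, d, e]"
    by (auto simp: length_Suc_conv eval_nat_numeral)
  have "\<forall>b \<in> set [1..<9]. \<forall>c \<in> set [1..<9]. \<forall>d \<in> set [1..<9].
      \<not> (distinct [3, b, c, d, 4] \<and>
         successively (joined ((4, 7) # (3, 8) # G_edges)) [3, b, c, d, 4])"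
    unfolding joined_def[abs_def] G_edges_def by code_simp
  then have "distinct [3, b, c, d, 4] \<Longrightarrow>
      \<not> successively (joined ((4, 7) # (3, 8) # G_edges)) [3, b, c, d, 4]"
    if "{b, c, d} \<subseteq> {1..8}"
    using that unfolding set_upt_1_9 by blast
  moreover have "{b, c, d} \<subseteq> {1..8}" "distinct [3, b, c, d, 4]"
      "successively (joined ((4, 7) # (3, 8) # G_edges)) [3, b, c, d, 4]"
    using assms by (auto simp: p path_between_iff_successively edges_graph_of)
  ultimately show False by blast
qed

section \<open>Certificates\<close>

text \<open>\<open>Cut cs\<close> colours vertex \<open>i\<close> by \<open>cs ! i\<close>: colour 0 marks the removed vertices, and there are no
  edges between different positive colours. \<open>Embed q\<close> sends vertex \<open>i\<close> of \<open>G\<close> to \<open>q ! (i - 1)\<close>.\<close>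

datatype cert =
    Split nat nat cert cert
  | Path "nat list"
  | Cut "nat list"
  | Embed "nat list"

text \<open>\<open>L\<close> and \<open>N\<close> collect the pairs known to be edges and non-edges
  on the current branch; all other pairs are undecided. A leaf is accepted only if this partial
  knowledge already yields its conclusion. \<open>Suc k\<close> counts the vertices of a path of
  length \<open>k\<close>.\<close>

fun check :: "nat \<Rightarrow> nat \<Rightarrow> (nat \<times> nat) list \<Rightarrow> (nat \<times> nat) list \<Rightarrow> cert \<Rightarrow> bool" where
  "check n k L N (Split i j c d) \<longleftrightarrow> check n k ((i, j) # L) N c \<and> check n k L ((i, j) # N) d"
| "check n k L N (Path ps) \<longleftrightarrow>
     length ps = Suc k \<and> hd ps = 0 \<and> last ps = n - 1 \<and> distinct ps \<and> list_all (\<lambda>i. i < n) ps \<and>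
     successively (joined L) ps"
| "check n k L N (Cut cs) \<longleftrightarrow>
     length cs = n \<and> 2 \<le> count_list cs 0 \<and>
     count_list cs 0 \<le> length (remdups (filter (\<lambda>c. c \<noteq> 0) cs)) \<and>
     (\<forall>i \<in> set [0..<n]. \<forall>j \<in> set [0..<n].
        cs ! i = 0 \<or> cs ! j = 0 \<or> cs ! i = cs ! j \<or> joined N i j)"
| "check n k L N (Embed q) \<longleftrightarrow>
     n = 8 \<and> length q = 8 \<and> distinct q \<and> list_all (\<lambda>i. i < 8) q \<and>
     (\<forall>i \<in> set [1..<9]. \<forall>j \<in> set [1..<9].
        (joined G_edges i j \<longrightarrow> joined L (q ! (i - 1)) (q ! (j - 1))) \<and>
        (i = j \<or> joined ((4, 7) # (3, 8) # G_edges) i j \<or> joined N (q ! (i - 1)) (q ! (j - 1))))"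

section \<open>Soundness of the certificates\<close>

text \<open>The pairs 38 and 47 stay free, so an \<open>Embed\<close> leaf may be reached before
  either is decided.\<close>

definition between_G_and_G_38_47 :: "'a graph \<Rightarrow> bool" where
  "between_G_and_G_38_47 H \<longleftrightarrow>
     (\<exists>g. bij_betw g {1..8} (verts H) \<and> (\<forall>i \<in> {1..8}. \<forall>j \<in> {1..8}.
        (joined G_edges i j \<longrightarrow> {g i, g j} \<in> edges H) \<and>
        ({g i, g j} \<in> edges H \<longrightarrow> joined ((4, 7) # (3, 8) # G_edges) i j)))"

text \<open>The known non-edges separate the positive colours, of which there are at least as many
  as removed vertices. This violates the separator bound, so the branch cannot occur.\<close>

lemma Cut_sound:
  assumes "check n k L N (Cut cs)" "hamiltonian_connected H"
    and xs: "distinct xs" "set xs = verts H" "length xs = n"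
    and N: "\<And>i j. joined N i j \<Longrightarrow> {xs ! i, xs ! j} \<notin> edges H"
  shows False
proof -
  have cs: "length cs = n" "2 \<le> count_list cs 0"
      "count_list cs 0 \<le> length (remdups (filter (\<lambda>c. c \<noteq> 0) cs))"
    and sep: "\<And>i j. \<lbrakk>i < n; j < n\<rbrakk> \<Longrightarrow> cs ! i = 0 \<or> cs ! j = 0 \<or> cs ! i = cs ! j \<or> joined N i j"
    using assms(1) unfolding check.simps set_upt atLeastLessThan_iff Ball_def by blast+
  \<comment> \<open>The colour of position \<open>i\<close> is transferred to the vertex
    \<open>xs ! i\<close>, unambiguously since \<open>xs\<close> is distinct.\<close>
  define col where "col v = the (map_of (zip xs cs) v)" for v
  have col: "col (xs ! i) = cs ! i" if "i < n" for i
    using that xs cs by (simp add: col_def map_of_zip_nth)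
  have map_col: "map col xs = cs"
    by (rule nth_equalityI) (use xs cs col in auto)
  have "card {v \<in> verts H. col v = 0} = length (filter (\<lambda>v. col v = 0) xs)"
    using xs distinct_card[of "filter (\<lambda>v. col v = 0) xs"] by simp
  also have "\<dots> = count_list (map col xs) 0"
    by (induction xs) auto
  finally have zeros: "card {v \<in> verts H. col v = 0} = count_list cs 0"
    by (simp add: map_col)
  moreover have "finite {v \<in> verts H. col v = 0}"
    by (simp flip: xs(2))
  \<comment> \<open>Two distinct removed vertices are needed as ends of the hamiltonian path behind
    the separator bound.\<close>
  ultimately obtain x y where xy:
      "x \<in> verts H" "y \<in> verts H" "x \<noteq> y" "col x = 0" "col y = 0"
    using cs(2) card_le_Suc0_iff_eq[of "{v \<in> verts H. col v = 0}"] by auto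
  have "col u = 0 \<or> col v = 0 \<or> col u = col v"
    if uv: "u \<in> verts H" "v \<in> verts H" "{u, v} \<in> edges H" for u v
  proof -
    obtain i j where "i < n" "j < n" "u = xs ! i" "v = xs ! j"
      using uv(1,2) xs(2,3) by (metis in_set_conv_nth)
    with sep[of i j] N[of i j] uv(3) show ?thesis by (auto simp: col)
  qed
  from hamiltonian_connected_separator[OF assms(2) xy this]
  have "card (col ` verts H - {0}) < count_list cs 0"
    unfolding zeros .
  moreover have "col ` verts H - {0} = set (filter (\<lambda>c. c \<noteq> 0) cs)"
    using map_col xs(2) by auto
  ultimately show False
    using cs(3) by (simp add: length_remdups_card_conv)
qed

lemma Embed_sound:
  assumes "check n k L N (Embed q)" "simple_graph H"
    and xs: "distinct xs" "set xs = verts H" "length xs = n"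
    and L: "\<And>i j. joined L i j \<Longrightarrow> {xs ! i, xs ! j} \<in> edges H"
    and N: "\<And>i j. joined N i j \<Longrightarrow> {xs ! i, xs ! j} \<notin> edges H"
  shows "between_G_and_G_38_47 H"
proof -
  have n: "n = 8" and q: "length q = 8" "distinct q" "list_all (\<lambda>i. i < 8) q"
    and qL: "\<And>i j. \<lbrakk>i \<in> {1..8}; j \<in> {1..8}; joined G_edges i j\<rbrakk>
      \<Longrightarrow> joined L (q ! (i - 1)) (q ! (j - 1))"
    and qN: "\<And>i j. \<lbrakk>i \<in> {1..8}; j \<in> {1..8}\<rbrakk> \<Longrightarrow> i = j \<or>
      joined ((4, 7) # (3, 8) # G_edges) i j \<or> joined N (q ! (i - 1)) (q ! (j - 1))"
    using assms(1) unfolding check.simps by auto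
  \<comment> \<open>Vertices of \<open>G\<close> count from 1, positions in \<open>q\<close> and
    \<open>xs\<close> from 0.\<close>
  let ?g = "\<lambda>i. xs ! (q ! (i - 1))"
  have lt: "q ! (i - 1) < 8" if "i \<in> {1..8}" for i
    using that q by (auto simp: list_all_length)
  have "inj_on ?g {1..8}"
  proof (rule inj_onI)
    fix i j :: nat assume ij: "i \<in> {1..8}" "j \<in> {1..8}" "?g i = ?g j"
    with lt xs n have "q ! (i - 1) = q ! (j - 1)" by (simp add: nth_eq_iff_index_eq)
    with ij q have "i - 1 = j - 1" by (subst (asm) nth_eq_iff_index_eq) auto
    with ij show "i = j" by auto
  qed
  moreover have "?g ` {1..8} = verts H"
  proof (rule card_subset_eq)
    show "?g ` {1..8} \<subseteq> verts H" using lt n xs(3) by (auto simp flip: xs(2))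
    show "card (?g ` {1..8}) = card (verts H)"
      using calculation n xs(1,3) by (simp add: card_image distinct_card flip: xs(2))
  qed (simp flip: xs(2))
  ultimately have "bij_betw ?g {1..8} (verts H)" by (simp add: bij_betw_def)
  \<comment> \<open>Absence of loops settles the case \<open>i = j\<close>, which the check exempts
    from its non-edge condition.\<close>
  moreover have "{v, v} \<notin> edges H" for v
    using assms(2) by (auto simp: simple_graph_def doubleton_eq_iff)
  ultimately show ?thesis
    unfolding between_G_and_G_38_47_def using L N qL qN by (intro exI[of _ ?g]) metis
qed

text \<open>At each \<open>Split\<close> the branch that is true of \<open>H\<close> is followed,
  which enlarges \<open>L\<close> or \<open>N\<close>; hence both are generalised in the induction.
  A \<open>Path\<close> or \<open>Cut\<close> leaf is contradictory, so only an \<open>Embed\<close>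
  leaf can be reached.\<close>

lemma check_sound:
  assumes "check n k L N c" "simple_graph H" "hamiltonian_connected H"
    and xs: "distinct xs" "set xs = verts H" "length xs = n" "0 < n"
    and no_path: "\<And>p. path_between H (xs ! 0) (xs ! (n - 1)) p \<Longrightarrow> path_length p \<noteq> k"
    and "\<And>i j. joined L i j \<Longrightarrow> {xs ! i, xs ! j} \<in> edges H"
    and "\<And>i j. joined N i j \<Longrightarrow> {xs ! i, xs ! j} \<notin> edges H"
  shows "between_G_and_G_38_47 H"
  using assms(1,9,10)
proof (induction c arbitrary: L N)
  case (Split i j c d)
  show ?case
  proof (cases "{xs ! i, xs ! j} \<in> edges H")
    case True
    with Split show ?thesis
      by (intro Split.IH(1)[of "(i, j) # L" N]) (auto simp: joined_def insert_commute)
  next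
    case False
    with Split show ?thesis
      by (intro Split.IH(2)[of L "(i, j) # N"]) (auto simp: joined_def insert_commute)
  qed
next
  case (Path ps)
  then have ps: "length ps = Suc k" "hd ps = 0" "last ps = n - 1" "distinct ps"
      "\<forall>i \<in> set ps. i < n" "successively (joined L) ps"
    by (auto simp: list_all_iff)
  then have "ps \<noteq> []" by auto
  have "path_between H (xs ! 0) (xs ! (n - 1)) (map ((!) xs) ps)"
    unfolding path_between_iff_successively
  proof (intro conjI)
    show "distinct (map ((!) xs) ps)"
      using ps xs by (auto simp: distinct_map inj_on_def nth_eq_iff_index_eq)
    show "successively (\<lambda>x y. {x, y} \<in> edges H) (map ((!) xs) ps)"
      using ps(6) Path.prems(2) by (auto simp: successively_map elim: successively_mono)
  qed (use ps xs(3,4) \<open>ps \<noteq> []\<close> in \<open>auto simp: hd_map last_map simp flip: xs(2)\<close>)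
  from no_path[OF this] ps(1) show ?case by (simp add: path_length_def)
next
  case (Cut cs)
  then show ?case using Cut_sound assms(3) xs by blast
next
  case (Embed q)
  then show ?case using Embed_sound assms(2) xs by blast
qed

section \<open>Numbering along a hamiltonian path\<close>

definition spine :: "nat \<Rightarrow> (nat \<times> nat) list" where
  "spine n = map (\<lambda>i. (i, Suc i)) [0..<n - 1]"

text \<open>Numbering along a hamiltonian path from \<open>u\<close> to \<open>v\<close> gives these
  vertices the numbers 0 and \<open>n - 1\<close>, where \<open>n\<close> is the order, and makes
  the edges of that path the initial knowledge.\<close>

lemma check_spine_sound:
  assumes "check (order_of H) k (spine (order_of H)) [] c" "simple_graph H" "hamiltonian_connected H"
    and "u \<in> verts H" "v \<in> verts H" "u \<noteq> v"
    and "\<nexists>p. path_between H u v p \<and> path_length p = k"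
  shows "between_G_and_G_38_47 H"
proof -
  obtain xs where xs: "path_between H u v xs" "set xs = verts H"
    using assms unfolding hamiltonian_connected_def by blast
  then have len: "length xs = order_of H" "xs \<noteq> []"
    by (auto simp: path_between_def order_of_def distinct_card dest: distinct_card)
  show ?thesis
  proof (rule check_sound[OF assms(1-3)])
    show "distinct xs" "set xs = verts H" "length xs = order_of H" "0 < order_of H"
      using xs len length_greater_0_conv[of xs]
      by (auto simp: path_between_def simp del: length_greater_0_conv)
    have "xs ! 0 = u" "xs ! (order_of H - 1) = v"
      using xs len by (auto simp: path_between_def hd_conv_nth last_conv_nth)
    then show "path_length p \<noteq> k"
      if "path_between H (xs ! 0) (xs ! (order_of H - 1)) p" for p
      using that assms(7) by auto
    show "{xs ! i, xs ! j} \<in> edges H" if "joined (spine (order_of H)) i j" for i j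
      using that xs len unfolding joined_def spine_def path_between_def
      by (auto simp: insert_commute)
  qed (simp add: joined_def)
qed

text \<open>The certificates were found by a computer search.\<close>

lemma certificates:
  "\<exists>c. check 4 2 (spine 4) [] c"
  "\<exists>c. check 5 3 (spine 5) [] c"
  "\<exists>c. check 6 3 (spine 6) [] c"
  "\<exists>c. check 6 4 (spine 6) [] c"
  "\<exists>c. check 7 4 (spine 7) [] c"
  "\<exists>c. check 7 5 (spine 7) [] c"
proof -
  show "\<exists>c. check 4 2 (spine 4) [] c"
    by (rule exI[of _ "Split 0 2 (Path [0, 2, 3]) (Cut [1, 0, 2, 0])"])
      code_simp
  show "\<exists>c. check 5 3 (spine 5) [] c"
    by (rule exI[of _
     "Split 0 2 (Path [0, 2, 3, 4]) (Split 2 4 (Path [0, 1, 2, 4]) (Cut [1, 0, 2, 0, 1]))"])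
      code_simp
  show "\<exists>c. check 6 3 (spine 6) [] c"
    by (rule exI[of _
     "Split 2 5 (Path [0, 1, 2, 5]) (Split 0 3 (Path [0, 3, 4, 5]) (Split 3 5 (Split 0 4 (Path [0,
     4, 3, 5]) (Split 0 2 (Path [0, 2, 3, 5]) (Cut [1, 0, 2, 2, 2, 0]))) (Split 1 5 (Split 0 2
     (Path [0, 2, 1, 5]) (Cut [1, 0, 2, 2, 0, 1])) (Cut [0, 1, 1, 1, 0, 2]))))"])
      code_simp
  show "\<exists>c. check 6 4 (spine 6) [] c"
    by (rule exI[of _
     "Split 3 5 (Path [0, 1, 2, 3, 5]) (Split 1 3 (Path [0, 1, 3, 4, 5]) (Split 0 3 (Split 1 5
     (Path [0, 3, 2, 1, 5]) (Cut [0, 1, 0, 2, 0, 3])) (Cut [1, 1, 0, 2, 0, 1])))"])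
      code_simp
  show "\<exists>c. check 7 4 (spine 7) [] c"
    by (rule exI[of _
     "Split 1 4 (Path [0, 1, 4, 5, 6]) (Split 0 3 (Path [0, 3, 4, 5, 6]) (Split 3 6 (Path [0, 1,
     2, 3, 6]) (Split 1 3 (Split 2 6 (Path [0, 1, 3, 2, 6]) (Split 4 6 (Path [0, 1, 3, 4, 6])
     (Split 1 6 (Split 0 4 (Path [0, 4, 3, 1, 6]) (Split 0 2 (Path [0, 2, 3, 1, 6]) (Cut [1, 0,
     2, 2, 2, 0, 1]))) (Cut [0, 1, 1, 1, 1, 0, 2])))) (Split 3 5 (Split 0 4 (Path [0, 4, 3, 5,
     6]) (Split 0 2 (Path [0, 2, 3, 5, 6]) (Split 4 6 (Split 0 5 (Path [0, 5, 3, 4, 6]) (Cut [1,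
     0, 2, 2, 2, 2, 0])) (Cut [1, 1, 0, 2, 2, 0, 1])))) (Cut [1, 1, 0, 2, 0, 1, 1])))))"])
      code_simp
  show "\<exists>c. check 7 5 (spine 7) [] c"
    by (rule exI[of _
     "Split 4 6 (Path [0, 1, 2, 3, 4, 6]) (Split 3 5 (Path [0, 1, 2, 3, 5, 6]) (Split 0 2 (Path
     [0, 2, 3, 4, 5, 6]) (Split 2 4 (Path [0, 1, 2, 4, 5, 6]) (Split 0 4 (Split 2 5 (Path [0, 4,
     3, 2, 5, 6]) (Split 2 6 (Split 1 5 (Path [0, 4, 5, 1, 2, 6]) (Split 0 5 (Path [0, 5, 4, 3,
     2, 6]) (Cut [1, 1, 1, 1, 0, 2, 0]))) (Cut [1, 0, 2, 0, 1, 1, 1]))) (Split 1 4 (Split 2 6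
     (Path [0, 1, 4, 3, 2, 6]) (Cut [1, 0, 2, 0, 3, 0, 1])) (Cut [1, 1, 1, 0, 2, 0, 1]))))))"])
      code_simp
qed

text \<open>This is the only certificate with \<open>Embed\<close> leaves: up to order 8, a missing
  path of admissible length occurs only for order 8 and length 4.\<close>

lemma certificate_8_4: "\<exists>c. check 8 4 (spine 8) [] c"
  by (rule exI[of _
     "Split 2 6 (Path [0, 1, 2, 6, 7]) (Split 0 4 (Path [0, 4, 5, 6, 7]) (Split 1 5 (Path [0, 1,
     5, 6, 7]) (Split 3 7 (Path [0, 1, 2, 3, 7]) (Split 4 7 (Split 0 2 (Path [0, 2, 3, 4, 7])
     (Split 0 6 (Path [0, 6, 5, 4, 7]) (Split 2 4 (Path [0, 1, 2, 4, 7]) (Split 4 6 (Split 0 5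
     (Path [0, 5, 4, 6, 7]) (Split 0 3 (Path [0, 3, 4, 6, 7]) (Cut [1, 0, 2, 2, 2, 2, 2, 0])))
     (Cut [1, 0, 2, 0, 3, 0, 4, 0]))))) (Split 0 3 (Split 1 7 (Path [0, 3, 2, 1, 7]) (Split 3 5
     (Path [0, 3, 5, 6, 7]) (Split 5 7 (Path [0, 3, 4, 5, 7]) (Split 1 3 (Split 2 7 (Path [0, 1,
     3, 2, 7]) (Cut [0, 1, 1, 1, 1, 1, 0, 2])) (Cut [0, 1, 0, 2, 0, 3, 0, 4]))))) (Split 0 2
     (Split 1 6 (Path [0, 2, 1, 6, 7]) (Split 2 5 (Path [0, 2, 5, 6, 7]) (Split 3 6 (Path [0, 2,
     3, 6, 7]) (Split 1 3 (Split 1 7 (Path [0, 2, 3, 1, 7]) (Split 2 7 (Path [0, 1, 3, 2, 7])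
     (Split 5 7 (Split 3 5 (Path [0, 1, 3, 5, 7]) (Cut [0, 1, 1, 1, 0, 2, 2, 2])) (Cut [0, 1, 1,
     1, 1, 1, 0, 2])))) (Split 3 5 (Split 5 7 (Path [0, 2, 3, 5, 7]) (Split 0 5 (Split 2 7 (Path
     [0, 5, 3, 2, 7]) (Split 1 7 (Split 1 4 (Path [0, 5, 4, 1, 7]) (Split 4 6 (Path [0, 5, 4, 6,
     7]) (Cut [1, 1, 0, 2, 2, 0, 1, 1]))) (Cut [0, 1, 1, 1, 1, 1, 0, 2]))) (Split 1 4 (Split 0 7
     (Split 4 6 (Path [0, 1, 4, 6, 7]) (Split 0 6 (Split 2 4 (Split 2 7 (Path [0, 1, 4, 2, 7])
     (Split 1 7 (Path [0, 2, 4, 1, 7]) (Cut [0, 1, 1, 1, 1, 1, 0, 2]))) (Split 1 7 (Embed [6, 5,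
     0, 7, 4, 3, 2, 1]) (Split 2 7 (Embed [6, 5, 0, 7, 3, 4, 1, 2]) (Cut [0, 1, 1, 1, 1, 1, 0,
     2])))) (Cut [1, 1, 1, 1, 1, 0, 2, 0]))) (Cut [1, 0, 0, 2, 2, 2, 0, 3])) (Cut [1, 1, 0, 2, 2,
     2, 0, 1])))) (Cut [1, 1, 0, 2, 0, 1, 1, 1])))))) (Split 4 6 (Split 0 5 (Path [0, 5, 4, 6,
     7]) (Split 1 4 (Path [0, 1, 4, 6, 7]) (Split 0 6 (Split 5 7 (Path [0, 6, 4, 5, 7]) (Split 2
     7 (Split 1 3 (Path [0, 1, 3, 2, 7]) (Cut [1, 1, 0, 2, 2, 2, 0, 1])) (Cut [1, 0, 2, 2, 2, 2,
     0, 1]))) (Cut [1, 0, 2, 2, 2, 2, 2, 0])))) (Split 1 3 (Split 3 6 (Path [0, 1, 3, 6, 7])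
     (Split 2 7 (Path [0, 1, 3, 2, 7]) (Cut [1, 0, 2, 2, 2, 0, 1, 1]))) (Split 0 7 (Split 2 4
     (Split 1 4 (Split 2 7 (Path [0, 1, 4, 2, 7]) (Split 5 7 (Path [0, 1, 4, 5, 7]) (Split 1 7
     (Split 0 5 (Path [0, 5, 4, 1, 7]) (Cut [1, 0, 2, 2, 2, 2, 0, 1])) (Cut [0, 1, 1, 1, 1, 1, 0,
     2])))) (Split 3 6 (Split 1 6 (Split 5 7 (Path [0, 1, 6, 5, 7]) (Split 1 7 (Split 0 5 (Path
     [0, 5, 6, 1, 7]) (Cut [1, 1, 0, 2, 2, 2, 0, 1])) (Cut [0, 1, 0, 2, 2, 2, 0, 3]))) (Split 1 7
     (Split 2 5 (Split 0 5 (Path [0, 5, 2, 1, 7]) (Split 5 7 (Path [0, 1, 2, 5, 7]) (Cut [1, 1,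
     0, 2, 2, 2, 0, 1]))) (Split 3 5 (Split 0 5 (Path [0, 5, 3, 6, 7]) (Split 0 6 (Split 5 7
     (Path [0, 6, 3, 5, 7]) (Cut [1, 1, 0, 2, 2, 2, 0, 1])) (Cut [1, 0, 2, 2, 2, 2, 2, 0])))
     (Split 2 7 (Split 0 6 (Path [0, 6, 3, 2, 7]) (Split 0 5 (Path [0, 5, 4, 2, 7]) (Cut [1, 0,
     2, 2, 2, 2, 2, 0]))) (Split 0 5 (Embed [1, 2, 0, 7, 3, 4, 5, 6]) (Split 5 7 (Split 0 6
     (Embed [1, 2, 0, 7, 4, 3, 6, 5]) (Cut [1, 0, 2, 2, 2, 2, 2, 0])) (Cut [1, 1, 1, 1, 0, 2, 0,
     1])))))) (Cut [0, 1, 0, 2, 2, 2, 2, 2]))) (Cut [1, 1, 0, 2, 2, 0, 1, 1]))) (Split 2 7 (Split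
     0 6 (Split 2 5 (Path [0, 6, 5, 2, 7]) (Split 3 6 (Path [0, 6, 3, 2, 7]) (Split 1 4 (Split 1
     6 (Path [0, 6, 1, 2, 7]) (Split 3 5 (Split 0 5 (Path [0, 5, 3, 2, 7]) (Split 5 7 (Path [0,
     1, 4, 5, 7]) (Embed [6, 5, 0, 7, 3, 4, 1, 2]))) (Cut [1, 1, 0, 2, 0, 1, 1, 1]))) (Cut [1, 1,
     1, 0, 2, 0, 1, 1])))) (Cut [1, 0, 2, 0, 3, 0, 4, 0])) (Cut [1, 0, 2, 0, 3, 0, 1, 1])))
     (Split 2 7 (Split 0 6 (Split 3 6 (Path [0, 6, 3, 2, 7]) (Split 3 5 (Split 0 5 (Path [0, 5,
     3, 2, 7]) (Cut [1, 0, 2, 2, 2, 2, 0, 2])) (Cut [1, 1, 0, 2, 0, 1, 1, 1]))) (Cut [1, 0, 2, 2,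
     2, 0, 2, 2])) (Cut [1, 0, 2, 2, 2, 0, 0, 3])))))))))))"])
    code_simp

text \<open>All leaves are \<open>Path\<close> or \<open>Cut\<close>, so every branch is
  contradictory; the same holds for length 6.\<close>

lemma certificate_8_5: "\<exists>c. check 8 5 (spine 8) [] c"
  by (rule exI[of _
     "Split 3 6 (Path [0, 1, 2, 3, 6, 7]) (Split 1 4 (Path [0, 1, 4, 5, 6, 7]) (Split 4 7 (Path
     [0, 1, 2, 3, 4, 7]) (Split 2 5 (Path [0, 1, 2, 5, 6, 7]) (Split 0 3 (Path [0, 3, 4, 5, 6,
     7]) (Split 0 2 (Split 3 5 (Path [0, 2, 3, 5, 6, 7]) (Split 1 5 (Path [0, 2, 1, 5, 6, 7])
     (Split 4 6 (Path [0, 2, 3, 4, 6, 7]) (Split 5 7 (Path [0, 2, 3, 4, 5, 7]) (Split 0 5 (Split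
     2 7 (Path [0, 5, 4, 3, 2, 7]) (Split 2 4 (Path [0, 2, 4, 5, 6, 7]) (Split 0 4 (Split 1 7
     (Path [0, 4, 3, 2, 1, 7]) (Cut [0, 1, 1, 0, 2, 2, 0, 3])) (Cut [1, 1, 1, 0, 2, 0, 1, 1]))))
     (Cut [1, 1, 1, 1, 0, 2, 0, 1])))))) (Split 5 7 (Split 2 6 (Path [0, 1, 2, 6, 5, 7]) (Split 2
     4 (Path [0, 1, 2, 4, 5, 7]) (Split 1 3 (Path [0, 1, 3, 4, 5, 7]) (Split 2 7 (Split 3 5 (Path
     [0, 1, 2, 3, 5, 7]) (Split 3 7 (Split 0 6 (Path [0, 6, 5, 4, 3, 7]) (Split 0 5 (Path [0, 5,
     4, 3, 2, 7]) (Cut [1, 0, 2, 2, 0, 3, 3, 0]))) (Cut [1, 1, 0, 2, 0, 1, 1, 1]))) (Cut [1, 0,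
     2, 0, 1, 1, 1, 1]))))) (Split 3 7 (Split 2 4 (Path [0, 1, 2, 4, 3, 7]) (Split 0 6 (Path [0,
     6, 5, 4, 3, 7]) (Split 1 5 (Path [0, 1, 5, 4, 3, 7]) (Split 2 6 (Split 0 5 (Path [0, 5, 6,
     2, 3, 7]) (Split 0 4 (Path [0, 4, 3, 2, 6, 7]) (Cut [1, 0, 2, 2, 2, 2, 2, 0]))) (Split 2 7
     (Split 0 5 (Path [0, 5, 4, 3, 2, 7]) (Split 0 4 (Split 3 5 (Path [0, 4, 3, 5, 6, 7]) (Cut
     [1, 1, 1, 1, 0, 2, 0, 1])) (Cut [1, 0, 2, 2, 2, 2, 2, 0]))) (Cut [1, 0, 2, 0, 1, 1, 1,
     1])))))) (Split 3 5 (Split 1 3 (Path [0, 1, 3, 5, 6, 7]) (Split 0 4 (Path [0, 4, 3, 5, 6,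
     7]) (Split 4 6 (Split 0 5 (Path [0, 5, 3, 4, 6, 7]) (Split 1 5 (Path [0, 1, 5, 4, 6, 7])
     (Cut [1, 1, 0, 2, 2, 2, 0, 1]))) (Cut [1, 1, 0, 2, 2, 0, 1, 1])))) (Split 1 3 (Split 2 6
     (Path [0, 1, 3, 2, 6, 7]) (Split 2 7 (Split 0 4 (Path [0, 4, 3, 1, 2, 7]) (Split 4 6 (Path
     [0, 1, 3, 4, 6, 7]) (Split 2 4 (Path [0, 1, 3, 4, 2, 7]) (Cut [1, 1, 1, 0, 2, 0, 1, 1]))))
     (Cut [1, 0, 2, 2, 0, 1, 1, 1]))) (Cut [1, 1, 0, 2, 0, 1, 1, 1]))))))))))"])
    code_simp

lemma certificate_8_6: "\<exists>c. check 8 6 (spine 8) [] c"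
  by (rule exI[of _
     "Split 3 5 (Path [0, 1, 2, 3, 5, 6, 7]) (Split 0 2 (Path [0, 2, 3, 4, 5, 6, 7]) (Split 1 3
     (Path [0, 1, 3, 4, 5, 6, 7]) (Split 5 7 (Path [0, 1, 2, 3, 4, 5, 7]) (Split 2 4 (Path [0, 1,
     2, 4, 5, 6, 7]) (Split 1 5 (Split 2 7 (Path [0, 1, 5, 4, 3, 2, 7]) (Split 3 6 (Path [0, 1,
     5, 4, 3, 6, 7]) (Split 0 3 (Path [0, 3, 2, 1, 5, 6, 7]) (Split 3 7 (Split 2 5 (Path [0, 1,
     2, 5, 4, 3, 7]) (Split 2 6 (Path [0, 1, 5, 6, 2, 3, 7]) (Cut [1, 0, 2, 0, 1, 1, 1, 1])))
     (Cut [1, 1, 0, 2, 0, 1, 1, 1]))))) (Split 0 5 (Split 1 7 (Path [0, 5, 4, 3, 2, 1, 7]) (Split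
     3 7 (Split 1 4 (Path [0, 5, 4, 1, 2, 3, 7]) (Split 1 6 (Path [0, 1, 6, 5, 4, 3, 7]) (Cut [0,
     1, 0, 2, 2, 2, 2, 2]))) (Cut [0, 1, 0, 2, 0, 3, 0, 4]))) (Split 2 5 (Split 3 7 (Path [0, 1,
     2, 5, 4, 3, 7]) (Split 1 7 (Split 0 3 (Path [0, 3, 4, 5, 2, 1, 7]) (Cut [1, 1, 0, 2, 0, 3,
     0, 1])) (Cut [0, 1, 0, 2, 0, 3, 0, 4]))) (Cut [1, 1, 1, 1, 0, 2, 0, 1]))))))))"])
    code_simp

section \<open>Classification\<close>

lemma counterexample_between:
  assumes "faudree_schelp_counterexample H" "order_of H \<le> 8"
  shows "between_G_and_G_38_47 H"
proof -
  obtain u v k where uv: "u \<in> verts H" "v \<in> verts H" "u \<noteq> v"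
    and k: "real (order_of H) / 2 \<le> real k" "k \<le> order_of H - 1"
    and no_path: "\<nexists>p. path_between H u v p \<and> path_length p = k"
    and H: "simple_graph H" "hamiltonian_connected H"
    using assms(1) unfolding faudree_schelp_counterexample_def by blast
  obtain xs where xs: "path_between H u v xs" "length xs = order_of H"
    using H uv unfolding hamiltonian_connected_iff_has_prop_P[OF H(1)] has_prop_P_def by meson
  then have "path_length xs = order_of H - 1" by (simp add: path_length_def)
  \<comment> \<open>The largest admissible length is realised by the hamiltonian path
    itself.\<close>
  with xs(1) no_path have "k \<noteq> order_of H - 1" by blast
  with k(2) assms(2) have "order_of H \<in> set [0..<9]" "k \<in> set [0..<order_of H - 1]" by simp_all
  moreover from k(1) have "order_of H \<le> 2 * k" by linarith
  \<comment> \<open>Orders up to 3 leave no length to consider; larger ones leave exactly the nine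
    certified pairs.\<close>
  moreover have "\<forall>n \<in> set [0..<9]. \<forall>k \<in> set [0..<n - 1]. n \<le> 2 * k \<longrightarrow>
      (n, k) \<in> set [(4, 2), (5, 3), (6, 3), (6, 4), (7, 4), (7, 5), (8, 4), (8, 5), (8, 6)]"
    by code_simp
  ultimately have "(order_of H, k) \<in>
      set [(4, 2), (5, 3), (6, 3), (6, 4), (7, 4), (7, 5), (8, 4), (8, 5), (8, 6)]"
    by blast
  moreover have "list_all (\<lambda>(n, k). \<exists>c. check n k (spine n) [] c)
      [(4, 2), (5, 3), (6, 3), (6, 4), (7, 4), (7, 5), (8, 4), (8, 5), (8, 6)]"
    using certificates certificate_8_4 certificate_8_5 certificate_8_6
    by (simp only: list.pred_inject prod.case simp_thms)
  ultimately have "\<exists>c. check (order_of H) k (spine (order_of H)) [] c"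
    unfolding list_all_iff by blast
  with check_spine_sound[OF _ H uv no_path] show ?thesis by blast
qed

text \<open>Only the presence of 38 and of 47 is open, which gives four graphs;
  \<open>G + 47\<close> is absorbed by the isomorphic \<open>G + 38\<close>.\<close>

lemma isomorphic_if_between:
  assumes "between_G_and_G_38_47 H"
  shows "isomorphic H graph_G \<or> isomorphic H (add_edge graph_G 3 8) \<or>
    isomorphic H (add_edge (add_edge graph_G 3 8) 4 7)"
proof -
  obtain g where g: "bij_betw g {1..8} (verts H)"
    and lower: "\<And>i j. \<lbrakk>i \<in> {1..8}; j \<in> {1..8}; joined G_edges i j\<rbrakk> \<Longrightarrow> {g i, g j} \<in> edges H"
    and upper: "\<And>i j. \<lbrakk>i \<in> {1..8}; j \<in> {1..8}; {g i, g j} \<in> edges H\<rbrakk>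
      \<Longrightarrow> joined ((4, 7) # (3, 8) # G_edges) i j"
    using assms unfolding between_G_and_G_38_47_def by blast
  have Cons: "joined ((a, b) # es) i j \<longleftrightarrow> {i, j} = {a, b} \<or> joined es i j" for a b es i j
    by (auto simp: joined_def doubleton_eq_iff)
  \<comment> \<open>Makes the status of 38 and 47 independent of the orientation in which the pair
    is given.\<close>
  have img: "{g i, g j} \<in> edges H \<longleftrightarrow> {g a, g b} \<in> edges H" if "{i, j} = {a, b}" for i j a b
    using that by (auto simp: doubleton_eq_iff insert_commute)
  define e38 e47 where "e38 \<longleftrightarrow> {g 3, g 8} \<in> edges H" and "e47 \<longleftrightarrow> {g 4, g 7} \<in> edges H"
  have edges: "{g i, g j} \<in> edges H \<longleftrightarrow>
      joined G_edges i j \<or> {i, j} = {3, 8} \<and> e38 \<or> {i, j} = {4, 7} \<and> e47"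
    if "i \<in> {1..8}" "j \<in> {1..8}" for i j
    using lower[OF that] upper[OF that] img[of i j 3 8] img[of i j 4 7]
    unfolding Cons e38_def e47_def by satx
  consider "\<not> e38" "\<not> e47" | "e38" "\<not> e47" | "\<not> e38" "e47" | "e38" "e47"
    by blast
  then show ?thesis
  proof cases
    case 1
    have "isomorphic H (graph_of G_edges)"
      by (rule isomorphic_graph_ofI[OF g]) (use 1 in \<open>auto simp: edges Cons\<close>)
    then show ?thesis by (simp add: graph_G_eq)
  next
    case 2
    have "isomorphic H (graph_of ((3, 8) # G_edges))"
      by (rule isomorphic_graph_ofI[OF g]) (use 2 in \<open>auto simp: edges Cons\<close>)
    then show ?thesis by (simp add: graph_G_eq add_edge_graph_of)
  next
    case 3
    have "isomorphic H (graph_of ((4, 7) # G_edges))"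
      by (rule isomorphic_graph_ofI[OF g]) (use 3 in \<open>auto simp: edges Cons\<close>)
    then have "isomorphic H (graph_of ((3, 8) # G_edges))"
      by (rule isomorphic_trans[OF _ isomorphic_sym[OF isomorphic_G_38_G_47]])
    then show ?thesis by (simp add: graph_G_eq add_edge_graph_of)
  next
    case 4
    have "isomorphic H (graph_of ((4, 7) # (3, 8) # G_edges))"
      by (rule isomorphic_graph_ofI[OF g]) (use 4 in \<open>auto simp: edges Cons\<close>)
    then show ?thesis by (simp add: graph_G_eq add_edge_graph_of)
  qed
qed

theorem proposition1:
  defines "G1 \<equiv> add_edge graph_G 3 8"
    and "G2 \<equiv> add_edge (add_edge graph_G 3 8) 4 7"
  shows
    "isomorphic G1 (add_edge graph_G 4 7) \<and>
     \<not> isomorphic graph_G G1 \<and> \<not> isomorphic graph_G G2 \<and> \<not> isomorphic G1 G2 \<and>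
     (\<forall>X \<in> {graph_G, G1, G2}.
        simple_graph X \<and> order_of X = 8 \<and>
        has_prop_P (order_of X) X \<and> \<not> has_prop_P (order_of X div 2 + 1) X \<and>
        faudree_schelp_counterexample X) \<and>
     (\<forall>H :: 'a graph. order_of H < 8 \<longrightarrow> \<not> faudree_schelp_counterexample H) \<and>
     (\<forall>H :: 'a graph. order_of H = 8 \<and> faudree_schelp_counterexample H \<longrightarrow>
        isomorphic H graph_G \<or> isomorphic H G1 \<or> isomorphic H G2)"
proof (intro conjI)
  note eqs = G1_def G2_def graph_G_eq add_edge_graph_of
  have simple: "simple_graph graph_G" "simple_graph G1" "simple_graph G2"
    unfolding eqs by (rule simple_graph_of, simp add: G_edges_def)+
  have "card (edges graph_G) = 12" "card (edges G1) = 13" "card (edges G2) = 14"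
    unfolding eqs by (simp_all add: edges_def graph_of_def G_edges_def doubleton_eq_iff)
  with simple show "\<not> isomorphic graph_G G1" "\<not> isomorphic graph_G G2" "\<not> isomorphic G1 G2"
    by (auto dest!: isomorphic_card_edges[rotated 2])
  show "isomorphic G1 (add_edge graph_G 4 7)"
    unfolding eqs by (rule isomorphic_G_38_G_47)
  show "\<forall>X \<in> {graph_G, G1, G2}.
        simple_graph X \<and> order_of X = 8 \<and>
        has_prop_P (order_of X) X \<and> \<not> has_prop_P (order_of X div 2 + 1) X \<and>
        faudree_schelp_counterexample X"
  proof
    fix X assume X: "X \<in> {graph_G, G1, G2}"
    then have X_simple: "simple_graph X" using simple by blast
    obtain es where es: "X = graph_of es"
        "es \<in> {G_edges, (3, 8) # G_edges, (4, 7) # (3, 8) # G_edges}"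
      using X unfolding eqs by blast
    then have verts: "verts X = {1..8}" by simp
    \<comment> \<open>Each of the three graphs is sandwiched: its hamiltonian paths come from the
      smallest graph, the missing path from the largest.\<close>
    have sub: "edges graph_G \<subseteq> edges X"
        "edges X \<subseteq> edges (graph_of ((4, 7) # (3, 8) # G_edges))"
      unfolding graph_G_eq es(1) by (rule edges_graph_of_mono, use es(2) in force)+
    have order: "order_of X = 8" by (simp add: order_of_def verts)
    have P8: "has_prop_P 8 X"
      by (rule has_prop_P_mono[OF has_prop_P_8_graph_G _ sub(1)]) (simp add: graph_G_eq verts)
    \<comment> \<open>One missing path serves twice: five vertices for the property, length 4 for
      the conjecture.\<close>
    have no_path: "\<nexists>p. path_between X 3 4 p \<and> length p = 5"
      using path_between_mono[OF _ _ sub(2)] no_path_3_4 by (metis verts verts_graph_of)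
    moreover have "3 \<in> verts X" "4 \<in> verts X" "3 \<noteq> (4 :: nat)" by (simp_all add: verts)
    ultimately have "\<not> has_prop_P 5 X"
      unfolding has_prop_P_def by blast
    moreover have "faudree_schelp_counterexample X"
      unfolding faudree_schelp_counterexample_def
    proof (intro conjI bexI exI)
      show "hamiltonian_connected X"
        using X_simple P8 by (simp add: hamiltonian_connected_iff_has_prop_P order)
      show "\<nexists>p. path_between X 3 4 p \<and> path_length p = 4"
        using no_path by (auto simp: path_length_def path_between_def)
    qed (simp_all add: X_simple order verts)
    ultimately show "simple_graph X \<and> order_of X = 8 \<and>
        has_prop_P (order_of X) X \<and> \<not> has_prop_P (order_of X div 2 + 1) X \<and>
        faudree_schelp_counterexample X"
      using X_simple P8 by (simp add: order)
  qed
  show "\<forall>H :: 'a graph. order_of H < 8 \<longrightarrow> \<not> faudree_schelp_counterexample H"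
  proof (intro allI impI notI)
    fix H :: "'a graph" assume H: "order_of H < 8" "faudree_schelp_counterexample H"
    \<comment> \<open>The labelling by 1 to 8 forces order 8.\<close>
    then obtain g where "bij_betw g {1..8::nat} (verts H)"
      using counterexample_between[of H] unfolding between_G_and_G_38_47_def by force
    then have "order_of H = 8" by (auto simp: order_of_def dest: bij_betw_same_card)
    with H show False by simp
  qed
  show "\<forall>H :: 'a graph. order_of H = 8 \<and> faudree_schelp_counterexample H \<longrightarrow>
        isomorphic H graph_G \<or> isomorphic H G1 \<or> isomorphic H G2"
    unfolding G1_def G2_def using isomorphic_if_between[OF counterexample_between] by (metis order_refl)
qed

end
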